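(* Let $\mathscr{C}\in\{\smile,\frown,\bowtie\}$ be one of the three adjacency relations (lower, upper, spatial), and let $\mathcal{M}=(\mathcal{K},P,\nu)$ be a simplicial model with $\mathscr{C}$-bounded adjacency. Then the logic $L_N$ and $\mathscr{C}$-bisimilarity induce the same identification on simplices: for all $\sigma_1,\sigma_2\in\mathcal{K}$, $\sigma_1$ and $\sigma_2$ are $\mathscr{C}$-bisimilar if and only if $\sigma_1\sim^{\mathscr{C}}_{L_N}\sigma_2$.
   Context: **Simplicial complexes.** A simplex is a finite nonempty set of vertices; $\sigma=[v_1,\dots,v_{k+1}]$ denotes the simplex with vertex set $\{v_1,\dots,v_{k+1}\}$, and its dimension is $\dim(\sigma)=|\sigma|-1$ (a $k$-simplex is a simplex of dimension $k$). A face of a simplex $\sigma$ is a simplex whose vertex set is a proper nonempty subset of that of $\sigma$. A simplicial complex $\mathcal{K}$ is a collection of simplices such that every face of a simplex of $\mathcal{K}$ is in $\mathcal{K}$, and the intersection of any two simplices of $\mathcal{K}$ is either empty or a (possibly non-proper) face of both. **Adjacency.** For distinct simplices of $\mathcal{K}$: - Lower adjacency: $\sigma_i\smile\sigma_j$ iff both are $k$-simplices (same $k$) and there is a $(k-1)$-simplex $\sigma\in\mathcal{K}$ with $\sigma\subset\sigma_i$ and $\sigma\subset\sigma_j$. - Upper adjacency: $\sigma_i\frown\sigma_j$ iff both are $k$-simplices (same $k$) and there is a $(k+1)$-simplex $\sigma\in\mathcal{K}$ with $\sigma_i\subset\sigma$ and $\sigma_j\subset\sigma$. - Spatial adjacency: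 $\sigma_i\bowtie\sigma_j$ iff $\sigma_i\cap\sigma_j\neq\emptyset$ (dimensions arbitrary). **Models.** A simplicial model is a triple $\mathcal{M}=(\mathcal{K},P,\nu)$ where $\mathcal{K}$ is a simplicial complex, $P$ is a finite or countable set of atomic propositions, and $\nu$ assigns to each $a\in P$ the set $\nu(a)\subseteq\mathcal{K}$ of simplices where $a$ holds. $\mathcal{M}$ has $\mathscr{C}$-bounded adjacency if for every $\sigma\in\mathcal{K}$ the set of simplices of $\mathcal{K}$ that are $\mathscr{C}$-adjacent to $\sigma$ is finite. **Logic $L_N$.** Formulas: $\varphi ::= a\mid\top\mid\lnot\varphi\mid\varphi_1\wedge\varphi_2\mid\mathcal{N}\varphi$ with $a\in P$. Semantics: $[\![a]\!]_{\mathscr{C}}=\nu(a)$, $[\![\top]\!]_{\mathscr{C}}=\mathcal{K}$, $[\![\varphi_1\wedge\varphi_2]\!]_{\mathscr{C}}=[\![\varphi_1]\!]_{\mathscr{C}}\cap[\![\varphi_2]\!]_{\mathscr{C}}$, $[\![\lnot\varphi]\!]_{\mathscr{C}}=\mathcal{K}\setminus[\![\varphi]\!]_{\mathscr{C}}$, $[\![\mathcal{N}\varphi]\!]_{\mathscr{C}}=\{\sigma_1\in\mathcal{K}:\exists\,\sigma_2\in[\![\varphi]\!]_{\mathscr{C}}\text{ with }\sigma_1\,\mathscr{C}\,\sigma_2\}$. Define $\sigma_1\sim^{\mathscr{C}}_{L_N}\sigma_2$ iff for all $\varphi\in L_N$: $\sigma_1\in[\![\varphi]\!]_{\mathscr{C}}\iff\sigma_2\in[\![\varphi]\!]_{\mathscr{C}}$.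 **$\mathscr{C}$-bisimulation.** A $\mathscr{C}$-bisimulation between simplicial models $\mathcal{M}_1=(\mathcal{K}_1,P,\nu_1)$ and $\mathcal{M}_2=(\mathcal{K}_2,P,\nu_2)$ is a non-empty relation $\mathcal{B}\subseteq\mathcal{K}_1\times\mathcal{K}_2$ such that whenever $(\sigma_1,\sigma_2)\in\mathcal{B}$: (a) for all $a\in P$, $\sigma_1\in\nu_1(a)$ iff $\sigma_2\in\nu_2(a)$; (b) for all $\sigma_1'$ with $\sigma_1\,\mathscr{C}\,\sigma_1'$ there is $\sigma_2'$ with $\sigma_2\,\mathscr{C}\,\sigma_2'$ and $(\sigma_1',\sigma_2')\in\mathcal{B}$; (c) for all $\sigma_2'$ with $\sigma_2\,\mathscr{C}\,\sigma_2'$ there is $\sigma_1'$ with $\sigma_1\,\mathscr{C}\,\sigma_1'$ and $(\sigma_1',\sigma_2')\in\mathcal{B}$. Simplices $\sigma_1\in\mathcal{K}_1$ and $\sigma_2\in\mathcal{K}_2$ are $\mathscr{C}$-bisimilar if some $\mathscr{C}$-bisimulation between $\mathcal{M}_1$ and $\mathcal{M}_2$ contains $(\sigma_1,\sigma_2)$. In the claim, $\mathcal{M}_1=\mathcal{M}_2=\mathcal{M}$. *)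

theory Defs
  imports Main "HOL-Library.Countable_Set"
begin

text \<open>Simplices are identified with their vertex sets.\<close>

definition simplex :: "'v set \<Rightarrow> bool" where
  "simplex \<sigma> \<longleftrightarrow> finite \<sigma> \<and> \<sigma> \<noteq> {}"

text \<open>The dimension is an integer, so that \<open>k - 1\<close> is not truncated when \<open>k = 0\<close>: there is no
  simplex of dimension \<open>-1\<close>, hence no vertex is lower adjacent to anything.\<close>

definition sdim :: "'v set \<Rightarrow> int" where
  "sdim \<sigma> = int (card \<sigma>) - 1"

definition face :: "'v set \<Rightarrow> 'v set \<Rightarrow> bool" where
  "face \<tau> \<sigma> \<longleftrightarrow> \<tau> \<noteq> {} \<and> \<tau> \<subset> \<sigma>"

definition simplicial_complex :: "'v set set \<Rightarrow> bool" where
  "simplicial_complex K \<longleftrightarrow>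
     (\<forall>\<sigma>\<in>K. simplex \<sigma>) \<and>
     (\<forall>\<sigma>\<in>K. \<forall>\<tau>. face \<tau> \<sigma> \<longrightarrow> \<tau> \<in> K) \<and>
     (\<forall>\<sigma>\<in>K. \<forall>\<tau>\<in>K. \<sigma> \<inter> \<tau> = {} \<or>
        ((\<sigma> \<inter> \<tau> = \<sigma> \<or> face (\<sigma> \<inter> \<tau>) \<sigma>) \<and> (\<sigma> \<inter> \<tau> = \<tau> \<or> face (\<sigma> \<inter> \<tau>) \<tau>)))"


definition lower_adjacent :: "'v set set \<Rightarrow> 'v set \<Rightarrow> 'v set \<Rightarrow> bool" where
  "lower_adjacent K \<sigma>\<^sub>1 \<sigma>\<^sub>2 \<longleftrightarrow>
     \<sigma>\<^sub>1 \<in> K \<and> \<sigma>\<^sub>2 \<in> K \<and> \<sigma>\<^sub>1 \<noteq> \<sigma>\<^sub>2 \<and>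
     (\<exists>k. sdim \<sigma>\<^sub>1 = k \<and> sdim \<sigma>\<^sub>2 = k \<and>
        (\<exists>\<sigma>\<in>K. sdim \<sigma> = k - 1 \<and> \<sigma> \<subset> \<sigma>\<^sub>1 \<and> \<sigma> \<subset> \<sigma>\<^sub>2))"

definition upper_adjacent :: "'v set set \<Rightarrow> 'v set \<Rightarrow> 'v set \<Rightarrow> bool" where
  "upper_adjacent K \<sigma>\<^sub>1 \<sigma>\<^sub>2 \<longleftrightarrow>
     \<sigma>\<^sub>1 \<in> K \<and> \<sigma>\<^sub>2 \<in> K \<and> \<sigma>\<^sub>1 \<noteq> \<sigma>\<^sub>2 \<and>
     (\<exists>k. sdim \<sigma>\<^sub>1 = k \<and> sdim \<sigma>\<^sub>2 = k \<and>
        (\<exists>\<sigma>\<in>K. sdim \<sigma> = k + 1 \<and> \<sigma>\<^sub>1 \<subset> \<sigma> \<and> \<sigma>\<^sub>2 \<subset> \<sigma>))"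

definition spatially_adjacent :: "'v set set \<Rightarrow> 'v set \<Rightarrow> 'v set \<Rightarrow> bool" where
  "spatially_adjacent K \<sigma>\<^sub>1 \<sigma>\<^sub>2 \<longleftrightarrow>
     \<sigma>\<^sub>1 \<in> K \<and> \<sigma>\<^sub>2 \<in> K \<and> \<sigma>\<^sub>1 \<noteq> \<sigma>\<^sub>2 \<and> \<sigma>\<^sub>1 \<inter> \<sigma>\<^sub>2 \<noteq> {}"

datatype adjacency = Lower | Upper | Spatial

fun adjacent :: "adjacency \<Rightarrow> 'v set set \<Rightarrow> 'v set \<Rightarrow> 'v set \<Rightarrow> bool" where
  "adjacent Lower = lower_adjacent"
| "adjacent Upper = upper_adjacent"
| "adjacent Spatial = spatially_adjacent"


record ('v, 'p) model =
  complex :: "'v set set"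
  props :: "'p set"
  valuation :: "'p \<Rightarrow> 'v set set"

text \<open>Only the values of the valuation on the propositions of the model matter.\<close>

definition simplicial_model :: "('v, 'p) model \<Rightarrow> bool" where
  "simplicial_model M \<longleftrightarrow>
     simplicial_complex (complex M) \<and> countable (props M) \<and>
     (\<forall>a\<in>props M. valuation M a \<subseteq> complex M)"

definition bounded_adjacency :: "adjacency \<Rightarrow> ('v, 'p) model \<Rightarrow> bool" where
  "bounded_adjacency C M \<longleftrightarrow>
     (\<forall>\<sigma>\<in>complex M. finite {\<tau> \<in> complex M. adjacent C (complex M) \<sigma> \<tau>})"


datatype (atoms: 'p) formula =
    Atom 'p
  | Top
  | Neg "'p formula"
  | Conj "'p formula" "'p formula"
  | Near "'p formula"

text \<open>The formulas of the logic are those whose atoms belong to the given set of propositions.\<close>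

definition L_N :: "'p set \<Rightarrow> 'p formula set" where
  "L_N P = {\<phi>. atoms \<phi> \<subseteq> P}"

primrec sem :: "adjacency \<Rightarrow> ('v, 'p) model \<Rightarrow> 'p formula \<Rightarrow> 'v set set" where
  "sem C M (Atom a) = valuation M a"
| "sem C M Top = complex M"
| "sem C M (Neg \<phi>) = complex M - sem C M \<phi>"
| "sem C M (Conj \<phi> \<psi>) = sem C M \<phi> \<inter> sem C M \<psi>"
| "sem C M (Near \<phi>) =
     {\<sigma>\<^sub>1 \<in> complex M. \<exists>\<sigma>\<^sub>2 \<in> sem C M \<phi>. adjacent C (complex M) \<sigma>\<^sub>1 \<sigma>\<^sub>2}"

definition L_N_equivalent :: "adjacency \<Rightarrow> ('v, 'p) model \<Rightarrow> 'v set \<Rightarrow> 'v set \<Rightarrow> bool" where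
  "L_N_equivalent C M \<sigma>\<^sub>1 \<sigma>\<^sub>2 \<longleftrightarrow>
     (\<forall>\<phi>\<in>L_N (props M). \<sigma>\<^sub>1 \<in> sem C M \<phi> \<longleftrightarrow> \<sigma>\<^sub>2 \<in> sem C M \<phi>)"


text \<open>Bisimulations relate models over the same set of propositions.\<close>

definition bisimulation ::
  "adjacency \<Rightarrow> ('v, 'p) model \<Rightarrow> ('w, 'p) model \<Rightarrow> ('v set \<times> 'w set) set \<Rightarrow> bool" where
  "bisimulation C M\<^sub>1 M\<^sub>2 B \<longleftrightarrow>
     props M\<^sub>1 = props M\<^sub>2 \<and> B \<noteq> {} \<and> B \<subseteq> complex M\<^sub>1 \<times> complex M\<^sub>2 \<and>
     (\<forall>(\<sigma>\<^sub>1, \<sigma>\<^sub>2)\<in>B.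
        (\<forall>a\<in>props M\<^sub>1. \<sigma>\<^sub>1 \<in> valuation M\<^sub>1 a \<longleftrightarrow> \<sigma>\<^sub>2 \<in> valuation M\<^sub>2 a) \<and>
        (\<forall>\<sigma>\<^sub>1'. adjacent C (complex M\<^sub>1) \<sigma>\<^sub>1 \<sigma>\<^sub>1' \<longrightarrow>
           (\<exists>\<sigma>\<^sub>2'. adjacent C (complex M\<^sub>2) \<sigma>\<^sub>2 \<sigma>\<^sub>2' \<and> (\<sigma>\<^sub>1', \<sigma>\<^sub>2') \<in> B)) \<and>
        (\<forall>\<sigma>\<^sub>2'. adjacent C (complex M\<^sub>2) \<sigma>\<^sub>2 \<sigma>\<^sub>2' \<longrightarrow>
           (\<exists>\<sigma>\<^sub>1'. adjacent C (complex M\<^sub>1) \<sigma>\<^sub>1 \<sigma>\<^sub>1' \<and> (\<sigma>\<^sub>1', \<sigma>\<^sub>2') \<in> B)))"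

definition bisimilar ::
  "adjacency \<Rightarrow> ('v, 'p) model \<Rightarrow> ('w, 'p) model \<Rightarrow> 'v set \<Rightarrow> 'w set \<Rightarrow> bool" where
  "bisimilar C M\<^sub>1 M\<^sub>2 \<sigma>\<^sub>1 \<sigma>\<^sub>2 \<longleftrightarrow> (\<exists>B. bisimulation C M\<^sub>1 M\<^sub>2 B \<and> (\<sigma>\<^sub>1, \<sigma>\<^sub>2) \<in> B)"

end

theory Submission
  imports Defs
begin

text \<open>The nontrivial direction is the Hennessy-Milner argument: if no neighbour of \<open>\<sigma>\<^sub>2\<close> were
  equivalent to a given neighbour \<open>\<sigma>\<^sub>1'\<close> of \<open>\<sigma>\<^sub>1\<close>, then, there being only finitely many of them,
  the conjunction \<open>\<phi>\<close> of formulas separating \<open>\<sigma>\<^sub>1'\<close> from each one would make \<open>Near \<phi>\<close>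
  true at \<open>\<sigma>\<^sub>1\<close> and false at \<open>\<sigma>\<^sub>2\<close>. So logical equivalence is itself a bisimulation.\<close>

lemma adjacent_in_complex:
  assumes "adjacent C K \<sigma> \<tau>"
  shows "\<sigma> \<in> K" "\<tau> \<in> K"
  using assms
  by (cases C; simp add: lower_adjacent_def upper_adjacent_def spatially_adjacent_def)+

lemma L_N_simps [simp]:
  "Atom a \<in> L_N P \<longleftrightarrow> a \<in> P"
  "Top \<in> L_N P"
  "Neg \<phi> \<in> L_N P \<longleftrightarrow> \<phi> \<in> L_N P"
  "Conj \<phi> \<psi> \<in> L_N P \<longleftrightarrow> \<phi> \<in> L_N P \<and> \<psi> \<in> L_N P"
  "Near \<phi> \<in> L_N P \<longleftrightarrow> \<phi> \<in> L_N P"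
  by (auto simp: L_N_def)

lemma L_N_equivalent_sym: "L_N_equivalent C M \<sigma> \<tau> \<Longrightarrow> L_N_equivalent C M \<tau> \<sigma>"
  by (auto simp: L_N_equivalent_def)

lemma bisimulationD:
  assumes "bisimulation C M N B" and "(\<sigma>, \<tau>) \<in> B"
  shows "\<sigma> \<in> complex M" "\<tau> \<in> complex N"
    and "a \<in> props M \<Longrightarrow> \<sigma> \<in> valuation M a \<longleftrightarrow> \<tau> \<in> valuation N a"
    and "adjacent C (complex M) \<sigma> \<sigma>' \<Longrightarrow>
      \<exists>\<tau>'. adjacent C (complex N) \<tau> \<tau>' \<and> (\<sigma>', \<tau>') \<in> B"
    and "adjacent C (complex N) \<tau> \<tau>' \<Longrightarrow>
      \<exists>\<sigma>'. adjacent C (complex M) \<sigma> \<sigma>' \<and> (\<sigma>', \<tau>') \<in> B"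
  using assms unfolding bisimulation_def by blast+

text \<open>Structural induction with both simplices left arbitrary, since \<open>Near\<close>
  passes from a related pair to a pair of related neighbours.\<close>

lemma bisimulation_sem_iff:
  assumes B: "bisimulation C M N B"
  shows "\<lbrakk>\<phi> \<in> L_N (props M); (\<sigma>, \<tau>) \<in> B\<rbrakk> \<Longrightarrow> \<sigma> \<in> sem C M \<phi> \<longleftrightarrow> \<tau> \<in> sem C N \<phi>"
proof (induction \<phi> arbitrary: \<sigma> \<tau>)
  case (Atom a)
  then show ?case using bisimulationD(3)[OF B] by simp
next
  case (Near \<phi>)
  have \<phi>: "\<phi> \<in> L_N (props M)" using Near.prems by simp
  have "\<sigma> \<in> sem C M (Near \<phi>) \<longleftrightarrow> (\<exists>\<sigma>'\<in>sem C M \<phi>. adjacent C (complex M) \<sigma> \<sigma>')"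
    using bisimulationD(1)[OF B Near.prems(2)] by simp
  \<comment> \<open>The forth clause gives the left-to-right direction, the back clause the
    converse; the induction hypothesis carries \<open>\<phi>\<close> across the pair of neighbours
    obtained.\<close>
  also have "\<dots> \<longleftrightarrow> (\<exists>\<tau>'\<in>sem C N \<phi>. adjacent C (complex N) \<tau> \<tau>')"
    using Near.IH[OF \<phi>] bisimulationD(4,5)[OF B Near.prems(2)] by meson
  also have "\<dots> \<longleftrightarrow> \<tau> \<in> sem C N (Near \<phi>)"
    using bisimulationD(2)[OF B Near.prems(2)] by simp
  finally show ?case .
qed (use bisimulationD(1,2)[OF B] in auto)

text \<open>One separating formula per element of \<open>S\<close> is conjoined, starting from
  \<open>Top\<close>; finiteness of \<open>S\<close> keeps the conjunction a formula.\<close>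

lemma separating_formula:
  assumes "finite S" and "\<sigma> \<in> complex M" and "S \<subseteq> complex M"
    and "\<forall>\<tau>\<in>S. \<not> L_N_equivalent C M \<sigma> \<tau>"
  shows "\<exists>\<phi>\<in>L_N (props M). \<sigma> \<in> sem C M \<phi> \<and> S \<inter> sem C M \<phi> = {}"
  using assms(1,3,4)
proof (induction S rule: finite_induct)
  case empty
  show ?case using assms(2) by (intro bexI[of _ Top]) auto
next
  case (insert \<tau> S)
  then obtain \<phi> where \<phi>: "\<phi> \<in> L_N (props M)" "\<sigma> \<in> sem C M \<phi>" "S \<inter> sem C M \<phi> = {}"
    by auto
  obtain \<psi> where \<psi>: "\<psi> \<in> L_N (props M)" "\<sigma> \<in> sem C M \<psi> \<longleftrightarrow> \<tau> \<notin> sem C M \<psi>"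
    using insert.prems by (auto simp: L_N_equivalent_def)
  \<comment> \<open>Inequivalence does not say which of the two simplices satisfies
    \<open>\<psi>\<close>; negating if necessary makes the formula true at \<open>\<sigma>\<close>
    and false at \<open>\<tau>\<close>.\<close>
  define \<chi> where "\<chi> = (if \<sigma> \<in> sem C M \<psi> then \<psi> else Neg \<psi>)"
  have "\<chi> \<in> L_N (props M)" "\<sigma> \<in> sem C M \<chi>" "\<tau> \<notin> sem C M \<chi>"
    using \<psi> assms(2) by (auto simp: \<chi>_def)
  with \<phi> show ?case by (intro bexI[of _ "Conj \<phi> \<chi>"]) auto
qed

lemma L_N_equivalent_forth:
  assumes "bounded_adjacency C M" and "L_N_equivalent C M \<sigma> \<tau>"
    and adj: "adjacent C (complex M) \<sigma> \<sigma>'" and "\<tau> \<in> complex M"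
  shows "\<exists>\<tau>'. adjacent C (complex M) \<tau> \<tau>' \<and> L_N_equivalent C M \<sigma>' \<tau>'"
proof (rule ccontr)
  let ?S = "{\<tau>' \<in> complex M. adjacent C (complex M) \<tau> \<tau>'}"
  assume "\<not> ?thesis"
  moreover have "finite ?S" using assms(1,4) by (simp add: bounded_adjacency_def)
  ultimately obtain \<phi> where \<phi>: "\<phi> \<in> L_N (props M)" "\<sigma>' \<in> sem C M \<phi>" "?S \<inter> sem C M \<phi> = {}"
    using separating_formula[of ?S \<sigma>' M C] adjacent_in_complex[OF adj] by auto
  have "\<sigma> \<in> sem C M (Near \<phi>)" using \<phi>(2) adj adjacent_in_complex[OF adj] by auto
  \<comment> \<open>The semantics of \<open>Near\<close> stays folded so that the equivalence can be
    applied to the formula \<open>Near \<phi>\<close> as a whole.\<close>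
  then have "\<tau> \<in> sem C M (Near \<phi>)"
    using assms(2) \<phi>(1) by (simp add: L_N_equivalent_def del: sem.simps)
  then show False using \<phi>(3) adjacent_in_complex(2) by fastforce
qed

text \<open>The restriction to the complex is explicit because \<open>L_N_equivalent\<close> does
  not itself require its arguments to be simplices of \<open>M\<close>. The diagonal makes the
  relation non-empty.\<close>

lemma bisimulation_L_N_equivalent:
  assumes "bounded_adjacency C M" and "complex M \<noteq> {}"
  shows "bisimulation C M M
    {(\<sigma>, \<tau>). \<sigma> \<in> complex M \<and> \<tau> \<in> complex M \<and> L_N_equivalent C M \<sigma> \<tau>}" (is "bisimulation C M M ?B")
proof -
  have "?B \<noteq> {}" using assms(2) by (auto simp: L_N_equivalent_def)
  moreover have "\<sigma> \<in> valuation M a \<longleftrightarrow> \<tau> \<in> valuation M a"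
    if "(\<sigma>, \<tau>) \<in> ?B" "a \<in> props M" for \<sigma> \<tau> a
    using that by (auto simp: L_N_equivalent_def dest: bspec[of _ _ "Atom a"])
  moreover have "\<exists>\<tau>'. adjacent C (complex M) \<tau> \<tau>' \<and> (\<sigma>', \<tau>') \<in> ?B"
    if "(\<sigma>, \<tau>) \<in> ?B" "adjacent C (complex M) \<sigma> \<sigma>'" for \<sigma> \<tau> \<sigma>'
    using that L_N_equivalent_forth[OF assms(1), of \<sigma> \<tau> \<sigma>'] adjacent_in_complex by blast
  \<comment> \<open>The back clause is the forth clause with \<open>\<sigma>\<close> and
    \<open>\<tau>\<close> exchanged, by symmetry of logical equivalence.\<close>
  moreover have "\<exists>\<sigma>'. adjacent C (complex M) \<sigma> \<sigma>' \<and> (\<sigma>', \<tau>') \<in> ?B"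
    if "(\<sigma>, \<tau>) \<in> ?B" "adjacent C (complex M) \<tau> \<tau>'" for \<sigma> \<tau> \<tau>'
    using that L_N_equivalent_forth[OF assms(1), of \<tau> \<sigma> \<tau>'] adjacent_in_complex
      L_N_equivalent_sym by blast
  ultimately show ?thesis unfolding bisimulation_def by fast
qed

theorem theorem5p5:
  fixes C :: adjacency and M :: "('v, 'p) model"
  assumes "simplicial_model M" and "bounded_adjacency C M"
  shows "\<forall>\<sigma>\<^sub>1\<in>complex M. \<forall>\<sigma>\<^sub>2\<in>complex M.
    bisimilar C M M \<sigma>\<^sub>1 \<sigma>\<^sub>2 \<longleftrightarrow> L_N_equivalent C M \<sigma>\<^sub>1 \<sigma>\<^sub>2"
proof (intro ballI iffI)
  fix \<sigma>\<^sub>1 \<sigma>\<^sub>2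
  assume "bisimilar C M M \<sigma>\<^sub>1 \<sigma>\<^sub>2"
  then show "L_N_equivalent C M \<sigma>\<^sub>1 \<sigma>\<^sub>2"
    unfolding bisimilar_def L_N_equivalent_def using bisimulation_sem_iff by blast
next
  fix \<sigma>\<^sub>1 \<sigma>\<^sub>2
  assume "\<sigma>\<^sub>1 \<in> complex M" "\<sigma>\<^sub>2 \<in> complex M" "L_N_equivalent C M \<sigma>\<^sub>1 \<sigma>\<^sub>2"
  then show "bisimilar C M M \<sigma>\<^sub>1 \<sigma>\<^sub>2"
    unfolding bisimilar_def using bisimulation_L_N_equivalent[OF assms(2)] by blast
qed

end
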